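(* Let $n\ge 2$ and let $a_1,\ldots,a_{n-1}$ be positive integers, $\lambda=\sum_{i=1}^{n-1}a_i\omega_i$. For every $1\le i\le n-1$ choose a vertex $v_i$ of the polytope $P_{a_i\omega_i}$. Then the point $v_1+\ldots+v_{n-1}$ is a vertex of $P_\lambda$ if and only if for every $1\le i\le n-2$ the point $v_i+v_{i+1}$ is a vertex of the Minkowski sum $P_{a_i\omega_i}+P_{a_{i+1}\omega_{i+1}}$.
   Context: FFLV polytopes of type $A$: for nonnegative integers $b_1,\ldots,b_{n-1}$ and the $\mathfrak{sl}_n$-weight $\mu=\sum b_i\omega_i$ ($\omega_i$ the fundamental weights), let $U=\mathbb R^{\binom n2}$ with coordinates $x_{i,j}$, $1\le i<j\le n$. A Dyck path is a sequence $d=((i_1,j_1),\ldots,(i_N,j_N))$ of pairs with $1\le i_k<j_k\le n$, $j_1-i_1=j_N-i_N=1$, and for each $k<N$, $(i_{k+1},j_{k+1})$ equals $(i_k+1,j_k)$ or $(i_k,j_k+1)$. Put $S(x,d)=\sum_{(i,j)\in d}x_{i,j}$ and $M(\mu,d)=b_{i_1}+b_{i_1+1}+\ldots+b_{i_N}$. Then $P_\mu=\{x\in U: x_{i,j}\ge 0 \text{ for all } i<j,\ S(x,d)\le M(\mu,d)\text{ for all Dyck paths } d\}$. In particular $P_{a_i\omega_i}$ is this polytope for the weight with only the $i$-th coordinate nonzero and equal to $a_i$; $P_\lambda=P_{a_1\omega_1}+\ldots+P_{a_{n-1}\omega_{n-1}}$. *)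

theory Defs
  imports
    "HOL-Analysis.Analysis"
    "HOL-Analysis.Finite_Function_Topology"
    "HOL-Library.Set_Algebras"
begin

definition coord_pairs :: "nat \<Rightarrow> (nat \<times> nat) set" where
  "coord_pairs n = {(i, j). 1 \<le> i \<and> i < j \<and> j \<le> n}"

text \<open>
  The space of dimension \<open>n choose 2\<close> with coordinates \<open>x\<^sub>i\<^sub>j\<close>, \<open>1 \<le> i < j \<le> n\<close>, is the
  subspace of finitely supported functions on \<open>nat \<times> nat\<close> that vanish off \<open>coord_pairs n\<close>.
  In this way \<open>n\<close> can be an ordinary natural number while the library's real vector space
  structure (hence \<open>extreme_point_of\<close>) and Minkowski sums of sets remain available.
\<close>

type_synonym coords = "nat \<times> nat \<Rightarrow>\<^sub>0 real"

definition coord_space :: "nat \<Rightarrow> coords set" where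
  "coord_space n = {x. Poly_Mapping.keys x \<subseteq> coord_pairs n}"

definition dyck_path :: "nat \<Rightarrow> (nat \<times> nat) list \<Rightarrow> bool" where
  "dyck_path n d \<longleftrightarrow>
     d \<noteq> [] \<and> set d \<subseteq> coord_pairs n \<and>
     snd (hd d) = fst (hd d) + 1 \<and> snd (last d) = fst (last d) + 1 \<and>
     successively (\<lambda>(i, j) q. q = (i + 1, j) \<or> q = (i, j + 1)) d"

definition path_sum :: "coords \<Rightarrow> (nat \<times> nat) list \<Rightarrow> real" where
  "path_sum x d = (\<Sum>p\<leftarrow>d. Poly_Mapping.lookup x p)"

text \<open>
  A dominant integral weight \<open>\<Sum> b\<^sub>k \<omega>\<^sub>k\<close> is given by its coefficients \<open>b\<^sub>k\<close> with respect to the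
  fundamental weights; only the values \<open>b k\<close> with \<open>1 \<le> k \<le> n - 1\<close> matter.
\<close>

definition path_bound :: "(nat \<Rightarrow> nat) \<Rightarrow> (nat \<times> nat) list \<Rightarrow> nat" where
  "path_bound b d = (\<Sum>k = fst (hd d)..fst (last d). b k)"

definition fflv_polytope :: "nat \<Rightarrow> (nat \<Rightarrow> nat) \<Rightarrow> coords set" where
  "fflv_polytope n b =
     {x \<in> coord_space n.
        (\<forall>p\<in>coord_pairs n. 0 \<le> Poly_Mapping.lookup x p) \<and>
        (\<forall>d. dyck_path n d \<longrightarrow> path_sum x d \<le> real (path_bound b d))}"

definition fundamental_multiple :: "nat \<Rightarrow> nat \<Rightarrow> (nat \<Rightarrow> nat)" where
  "fundamental_multiple c i = (\<lambda>k. if k = i then c else 0)"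

end

theory Submission
  imports Defs
begin

text \<open>
  A vertex of the polytope of \<open>a\<^sub>i \<omega>\<^sub>i\<close> is \<open>a\<^sub>i\<close> times the indicator of an antichain \<open>A\<^sub>i\<close> of cells
  \<open>(p, q)\<close> with \<open>p \<le> i < q\<close>, for the componentwise order. One direction of the theorem is the fact
  that a partial sum of an extreme sum is extreme. For the other, join each cell of \<open>A\<^sub>i\<close> to the
  cells of \<open>A\<^sub>i\<^sub>+\<^sub>1\<close> comparable to it. A union of connected components of this graph can be swapped
  between \<open>A\<^sub>i\<close> and \<open>A\<^sub>i\<^sub>+\<^sub>1\<close> unless it meets column \<open>i + 1\<close> of \<open>A\<^sub>i\<close> or row \<open>i + 1\<close> of \<open>A\<^sub>i\<^sub>+\<^sub>1\<close>;
  extremality of \<open>v\<^sub>i + v\<^sub>i\<^sub>+\<^sub>1\<close> forbids every nontrivial swap. Consequently every cell of \<open>A\<^sub>i\<close> lies on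
  a chain meeting \<open>A\<^sub>k, \<dots>, A\<^sub>m\<close> that starts in row \<open>k\<close> and ends in column \<open>m + 1\<close>. Such a chain
  lies on a Dyck path whose inequality is tight at \<open>\<Sum>v\<^sub>i\<close>, and a direction \<open>u\<close> with zero sum along all
  these chains vanishes: by a second use of the swaps, \<open>u\<close> has zero sum on the part of such a chain below
  a cell and on the part above it, cell included, so \<open>u\<close> is zero at the cell.
\<close>

section \<open>Chains and antichains of cells, and points given by functions\<close>

definition is_chain :: "'a::order set \<Rightarrow> bool" where
  "is_chain C \<longleftrightarrow> (\<forall>x\<in>C. \<forall>y\<in>C. x \<le> y \<or> y \<le> x)"

definition is_antichain :: "'a::order set \<Rightarrow> bool" where
  "is_antichain A \<longleftrightarrow> (\<forall>x\<in>A. \<forall>y\<in>A. x \<le> y \<longrightarrow> x = y)"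

definition rect :: "nat \<Rightarrow> nat \<Rightarrow> (nat \<times> nat) set" where
  "rect n i = {(p, q). 1 \<le> p \<and> p \<le> i \<and> i < q \<and> q \<le> n}"

lemma rect_subset_coord_pairs: "rect n i \<subseteq> coord_pairs n"
  by (auto simp: rect_def coord_pairs_def)

lemma finite_coord_pairs [simp]: "finite (coord_pairs n)"
  by (rule finite_subset[of _ "{..n} \<times> {..n}"]) (auto simp: coord_pairs_def)

text \<open>Cutting \<open>f\<close> off outside the finite set \<open>coord_pairs n\<close> makes
  the support finite, so any function on cells describes a point.\<close>

definition coords_of :: "nat \<Rightarrow> (nat \<times> nat \<Rightarrow> real) \<Rightarrow> coords" where
  "coords_of n f = Abs_poly_mapping (\<lambda>p. if p \<in> coord_pairs n then f p else 0)"

lemma lookup_coords_of [simp]: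
  "Poly_Mapping.lookup (coords_of n f) p = (if p \<in> coord_pairs n then f p else 0)"
proof -
  have "finite {p. (if p \<in> coord_pairs n then f p else 0) \<noteq> 0}"
    by (rule finite_subset[OF _ finite_coord_pairs[of n]]) auto
  then show ?thesis by (simp add: coords_of_def)
qed

lemma coords_of_in_coord_space [simp]: "coords_of n f \<in> coord_space n"
  by (auto simp: coord_space_def in_keys_iff split: if_splits)

lemma lookup_eq_0_outside:
  "x \<in> coord_space n \<Longrightarrow> p \<notin> coord_pairs n \<Longrightarrow> Poly_Mapping.lookup x p = 0"
  by (auto simp: coord_space_def in_keys_iff)

lemma lookup_scaleR: "Poly_Mapping.lookup (r *\<^sub>R x) p = r * Poly_Mapping.lookup (x :: coords) p"
proof -
  have "finite {p. r * Poly_Mapping.lookup x p \<noteq> 0}"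
    by (rule finite_subset[OF _ finite_keys[of x]]) (auto simp: in_keys_iff)
  then show ?thesis by (simp add: scaleR_poly_mapping_def)
qed

subsection \<open>Dyck paths and chains\<close>

text \<open>Each step raises one coordinate by one and so is strict in the componentwise order;
  transitivity does the rest.\<close>

lemma dyck_path_sorted:
  assumes "dyck_path n d"
  shows "sorted_wrt (<) d"
proof -
  have "successively (\<lambda>(i, j) q. q = (i + 1, j) \<or> q = (i, j + 1)) d"
    using assms by (simp add: dyck_path_def)
  then have "successively (<) d"
    by (rule successively_mono) (auto simp: less_prod_def)
  then show ?thesis by (simp add: successively_conv_sorted_wrt)
qed

lemma dyck_path_distinct: "dyck_path n d \<Longrightarrow> distinct d"
  using dyck_path_sorted[of n d] by (auto simp: distinct_conv_nth linorder_neq_iff dest: sorted_wrt_nth_less)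

lemma sorted_wrt_less_is_chain:
  fixes d :: "'a::order list"
  shows "sorted_wrt (<) d \<Longrightarrow> is_chain (set d)"
  by (induction d) (auto simp: is_chain_def intro: less_imp_le)

lemma dyck_path_bounds:
  assumes "dyck_path n d" "(p, q) \<in> set d"
  shows "fst (hd d) \<le> p" "q \<le> fst (last d) + 1"
proof -
  have s: "sorted_wrt (<) d" using dyck_path_sorted assms by blast
  have d: "d \<noteq> []" using assms by auto
  have "hd d \<le> (p, q)"
    using s d assms(2) by (cases d) (auto intro: less_imp_le)
  then show "fst (hd d) \<le> p" by (simp add: less_eq_prod_def)
  have "(p, q) \<le> last d"
    using s d assms(2)
    by (cases d rule: rev_cases) (auto simp: sorted_wrt_append intro: less_imp_le)
  then show "q \<le> fst (last d) + 1" using assms(1) by (simp add: less_eq_prod_def dyck_path_def)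
qed

lemma path_sum_dyck_path:
  "dyck_path n d \<Longrightarrow> path_sum x d = (\<Sum>p\<in>set d. Poly_Mapping.lookup x p)"
  by (simp add: path_sum_def dyck_path_distinct sum_list_distinct_conv_sum_set)

text \<open>Greedy construction: move to the next column if this loses no remaining cell of
  \<open>C\<close>, otherwise to the next row. Up to the constant \<open>m\<close>, the measure
  counts the steps left to \<open>(m, m + 1)\<close>.\<close>

lemma lattice_path_through_chain:
  assumes "1 \<le> p" "p < q" "q \<le> m + 1" "m < n"
    and "is_chain C" "C \<subseteq> coord_pairs n" "\<And>c. c \<in> C \<Longrightarrow> (p, q) \<le> c" "\<And>c. c \<in> C \<Longrightarrow> snd c \<le> m + 1"
  shows "\<exists>d. d \<noteq> [] \<and> hd d = (p, q) \<and> last d = (m, m + 1) \<and> set d \<subseteq> coord_pairs n \<and>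
    successively (\<lambda>(i, j) q. q = (i + 1, j) \<or> q = (i, j + 1)) d \<and> C \<subseteq> set d"
  using assms
proof (induction "2 * m - p + (m + 1 - q)" arbitrary: p q C rule: less_induct)
  case less
  have pq: "(p, q) \<in> coord_pairs n" using less.prems by (auto simp: coord_pairs_def)
  show ?case
  proof (cases "p = m")
    case True
    have "C \<subseteq> {(m, m + 1)}"
    proof
      fix c assume "c \<in> C"
      then have "c \<in> coord_pairs n" "(p, q) \<le> c" "snd c \<le> m + 1" using less.prems by auto
      then show "c \<in> {(m, m + 1)}"
        using True by (cases c) (auto simp: coord_pairs_def)
    qed
    then show ?thesis
      using True less.prems(2,3) pq by (intro exI[of _ "[(p, q)]"]) (auto simp: le_Suc_eq)
  next
    case False
    then have pm: "p < m" using less.prems by auto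
    let ?C = "C - {(p, q)}"
    have ext: "\<exists>d. d \<noteq> [] \<and> hd d = (p, q) \<and> last d = (m, m + 1) \<and> set d \<subseteq> coord_pairs n \<and>
      successively (\<lambda>(i, j) q. q = (i + 1, j) \<or> q = (i, j + 1)) d \<and> C \<subseteq> set d"
      if st: "p' = p \<and> q' = q + 1 \<or> p' = p + 1 \<and> q' = q" "p' < q'" "q' \<le> m + 1"
        and ge: "\<And>c. c \<in> ?C \<Longrightarrow> (p', q') \<le> c" for p' q'
    proof -
      have "2 * m - p' + (m + 1 - q') < 2 * m - p + (m + 1 - q)" "1 \<le> p'"
        using st pm less.prems by auto
      moreover have "is_chain ?C" "?C \<subseteq> coord_pairs n" "\<And>c. c \<in> ?C \<Longrightarrow> snd c \<le> m + 1"
        using less.prems by (auto simp: is_chain_def)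
      ultimately obtain d where d: "d \<noteq> []" "hd d = (p', q')" "last d = (m, m + 1)" "set d \<subseteq> coord_pairs n"
        "successively (\<lambda>(i, j) q. q = (i + 1, j) \<or> q = (i, j + 1)) d" "?C \<subseteq> set d"
        using less.hyps[of p' q' ?C] st ge \<open>m < n\<close> by auto
      then show ?thesis
        using st pq by (intro exI[of _ "(p, q) # d"]) (auto simp: successively_Cons)
    qed
    show ?thesis
    proof (cases "q < m + 1 \<and> (\<forall>c\<in>?C. q < snd c)")
      case True
      have "(p, q + 1) \<le> c" if "c \<in> ?C" for c
      proof -
        have "q < snd c" "(p, q) \<le> c" using True that less.prems(7) by blast+
        then show ?thesis by (simp add: less_eq_prod_def)
      qed
      then show ?thesis using True less.prems(2) by (intro ext[of p "q + 1"]) auto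
    next
      case right: False
      \<comment> \<open>If the column step is blocked, a further cell in row \<open>p\<close> would
        be incomparable to a cell in column \<open>q\<close> below \<open>(p, q)\<close>.\<close>
      have rows: "p < fst c" if c: "c \<in> ?C" for c
      proof (rule ccontr)
        assume "\<not> p < fst c"
        then have fc: "fst c = p" "q < snd c"
          using less.prems(7)[of c] c by (cases c; auto)+
        then have "q < m + 1" using less.prems(8)[of c] c by auto
        then obtain c' where c': "c' \<in> ?C" "snd c' \<le> q" using right by (auto simp: not_less)
        then have "snd c' = q" "p < fst c'"
          using less.prems(7)[of c'] by (cases c'; auto)+
        moreover have "c \<le> c' \<or> c' \<le> c" using less.prems(5) c c' by (auto simp: is_chain_def)
        ultimately show False using fc by (auto simp: less_eq_prod_def)
      qed
      have "p + 1 < q"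
      proof (cases "q = m + 1")
        case True
        then show ?thesis using pm by simp
      next
        case False
        then obtain c where c: "c \<in> ?C" "snd c \<le> q" using right less.prems by (auto simp: not_less)
        moreover have "fst c < snd c" using c less.prems(6) by (auto simp: coord_pairs_def)
        ultimately show ?thesis using rows[of c] by auto
      qed
      moreover have "(p + 1, q) \<le> c" if "c \<in> ?C" for c
      proof -
        have "p < fst c" "(p, q) \<le> c" using rows that less.prems(7) by blast+
        then show ?thesis by (simp add: less_eq_prod_def)
      qed
      ultimately show ?thesis using less.prems(3) by (intro ext[of "p + 1" q]) auto
    qed
  qed
qed

lemma sum_set_le_sum_list:
  fixes f :: "'a \<Rightarrow> real"
  assumes "\<And>x. x \<in> set d \<Longrightarrow> 0 \<le> f x"
  shows "sum f (set d) \<le> sum_list (map f d)"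
  using assms
proof (induction d)
  case (Cons a d)
  then show ?case
    by (cases "a \<in> set d") (auto simp: insert_absorb intro: add_increasing)
qed simp

text \<open>Complete \<open>C\<close> to a Dyck path from \<open>(k, k + 1)\<close> to
  \<open>(m, m + 1)\<close>; the added cells carry nonnegative coordinates.\<close>

lemma chain_sum_le:
  assumes x: "x \<in> fflv_polytope n b" and km: "1 \<le> k" "k \<le> m" "m < n"
    and C: "is_chain C" "C \<subseteq> coord_pairs n"
    and rows: "\<And>c. c \<in> C \<Longrightarrow> k \<le> fst c" and cols: "\<And>c. c \<in> C \<Longrightarrow> snd c \<le> m + 1"
  shows "(\<Sum>c\<in>C. Poly_Mapping.lookup x c) \<le> (\<Sum>j = k..m. real (b j))"
proof -
  have "(k, k + 1) \<le> c" if "c \<in> C" for c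
    using rows[OF that] C(2) that by (cases c) (auto simp: coord_pairs_def)
  then obtain d where d: "d \<noteq> []" "hd d = (k, k + 1)" "last d = (m, m + 1)" "set d \<subseteq> coord_pairs n"
    "successively (\<lambda>(i, j) q. q = (i + 1, j) \<or> q = (i, j + 1)) d" "C \<subseteq> set d"
    using lattice_path_through_chain[of k "k + 1" m n C] km C cols by auto
  have nn: "0 \<le> Poly_Mapping.lookup x c" if "c \<in> set d" for c
    using x d(4) that by (auto simp: fflv_polytope_def)
  have "dyck_path n d" using d by (auto simp: dyck_path_def)
  then have "path_sum x d \<le> real (path_bound b d)" using x by (auto simp: fflv_polytope_def)
  moreover have "(\<Sum>c\<in>C. Poly_Mapping.lookup x c) \<le> (\<Sum>c\<in>set d. Poly_Mapping.lookup x c)"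
    by (rule sum_mono2) (use d nn in auto)
  moreover have "\<dots> \<le> path_sum x d"
    unfolding path_sum_def by (rule sum_set_le_sum_list) (use nn in auto)
  ultimately show ?thesis using d by (simp add: path_bound_def)
qed

subsection \<open>Vertices for multiples of fundamental weights\<close>

lemma path_bound_fundamental_multiple:
  "path_bound (fundamental_multiple c i) d = (if fst (hd d) \<le> i \<and> i \<le> fst (last d) then c else 0)"
  by (auto simp: path_bound_def fundamental_multiple_def)

lemma fflv_polytope_lookup_nonneg:
  "x \<in> fflv_polytope n b \<Longrightarrow> 0 \<le> Poly_Mapping.lookup x p"
  by (cases "p \<in> coord_pairs n") (auto simp: fflv_polytope_def lookup_eq_0_outside)

text \<open>A single cell \<open>(r, s)\<close> is a chain bounded by the coefficients with indices
  from \<open>r\<close> to \<open>s - 1\<close>, all zero unless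
  \<open>r \<le> i < s\<close>.\<close>

lemma lookup_fundamental_outside_rect:
  assumes x: "x \<in> fflv_polytope n (fundamental_multiple c i)" and p: "p \<notin> rect n i"
  shows "Poly_Mapping.lookup x p = 0"
proof (cases "p \<in> coord_pairs n")
  case False
  then show ?thesis using x by (auto simp: fflv_polytope_def lookup_eq_0_outside)
next
  case True
  obtain r s where rs: "p = (r, s)" by (cases p)
  have "(\<Sum>c\<in>{p}. Poly_Mapping.lookup x c) \<le> (\<Sum>j = r..s - 1. real (fundamental_multiple c i j))"
    using True rs by (intro chain_sum_le[OF x]) (auto simp: is_chain_def coord_pairs_def)
  also have "\<dots> = 0"
    using p True rs by (intro sum.neutral) (auto simp: fundamental_multiple_def rect_def coord_pairs_def)
  finally show ?thesis using fflv_polytope_lookup_nonneg[OF x, of p] by simp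
qed

text \<open>A Dyck path is a chain, so it meets \<open>A\<close> at most once. If it does, the
  common cell forces \<open>i\<close> between the end rows of the path, where the bound is
  \<open>c\<close>.\<close>

lemma antichain_in_fundamental:
  assumes A: "A \<subseteq> rect n i" "is_antichain A"
  shows "coords_of n (\<lambda>p. if p \<in> A then real c else 0) \<in> fflv_polytope n (fundamental_multiple c i)"
proof -
  let ?x = "coords_of n (\<lambda>p. if p \<in> A then real c else 0)"
  have "path_sum ?x d \<le> real (path_bound (fundamental_multiple c i) d)" if d: "dyck_path n d" for d
  proof -
    have "path_sum ?x d = (\<Sum>p\<in>set d. if p \<in> A then real c else 0)"
      using d unfolding path_sum_dyck_path[OF d] by (intro sum.cong) (auto simp: dyck_path_def)
    also have "\<dots> = real c * card (set d \<inter> A)"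
      by (simp flip: sum.inter_restrict)
    finally have eq: "path_sum ?x d = real c * card (set d \<inter> A)" .
    show ?thesis
    proof (cases "set d \<inter> A = {}")
      case True
      then show ?thesis using eq by simp
    next
      case False
      then obtain p where p: "p \<in> set d" "p \<in> A" by auto
      have "set d \<inter> A \<subseteq> {p}"
        using sorted_wrt_less_is_chain[OF dyck_path_sorted[OF d]] p A(2)
        unfolding is_chain_def is_antichain_def by blast
      then have "set d \<inter> A = {p}" using p by auto
      moreover obtain r s where rs: "p = (r, s)" by (cases p)
      ultimately show ?thesis
        using eq dyck_path_bounds[OF d, of r s] p A(1) rs
        by (auto simp: path_bound_fundamental_multiple rect_def)
    qed
  qed
  then show ?thesis by (auto simp: fflv_polytope_def)
qed

text \<open>
  The largest sum of a nonnegative \<open>f\<close> over a chain of cells below \<open>(p, q)\<close>, as in Stanley's transfer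
  map from the order polytope to the chain polytope; \<open>reshape \<phi>\<close> applies \<open>\<phi>\<close> to order polytope
  coordinates.
\<close>

fun height :: "(nat \<times> nat \<Rightarrow> real) \<Rightarrow> nat \<Rightarrow> nat \<Rightarrow> real" where
  "height f (Suc p) (Suc q) = f (Suc p, Suc q) + max (height f p (Suc q)) (height f (Suc p) q)"
| "height f _ _ = 0"

lemma height_nonneg: "(\<And>c. 0 \<le> f c) \<Longrightarrow> 0 \<le> height f p q"
  by (induction f p q rule: height.induct) (auto intro!: add_nonneg_nonneg simp: le_max_iff_disj)

text \<open>Follow the larger branch of the recursion and skip zeros of \<open>f\<close>, so that
  the chain stays in the support of \<open>f\<close>.\<close>

lemma height_chain:
  "\<exists>C. finite C \<and> is_chain C \<and> (\<forall>c\<in>C. c \<le> (p, q)) \<and> (\<forall>c\<in>C. f c \<noteq> 0) \<and> height f p q = sum f C"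
proof (induction f p q rule: height.induct)
  case (1 f p q)
  obtain C where C: "finite C" "is_chain C" "\<forall>c\<in>C. c < (Suc p, Suc q)" "\<forall>c\<in>C. f c \<noteq> 0"
    "max (height f p (Suc q)) (height f (Suc p) q) = sum f C"
  proof (cases "height f p (Suc q) \<le> height f (Suc p) q")
    case True
    obtain C where "finite C" "is_chain C" "\<forall>c\<in>C. c \<le> (Suc p, q)" "\<forall>c\<in>C. f c \<noteq> 0"
      "height f (Suc p) q = sum f C"
      using "1.IH"(2) by blast
    then show ?thesis using True by (intro that[of C]) (auto simp: max_def less_prod_def less_eq_prod_def)
  next
    case False
    obtain C where "finite C" "is_chain C" "\<forall>c\<in>C. c \<le> (p, Suc q)" "\<forall>c\<in>C. f c \<noteq> 0"
      "height f p (Suc q) = sum f C"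
      using "1.IH"(1) by blast
    then show ?thesis using False by (intro that[of C]) (auto simp: max_def less_prod_def less_eq_prod_def)
  qed
  show ?case
  proof (cases "f (Suc p, Suc q) = 0")
    case True
    then show ?thesis using C by (auto intro!: exI[of _ C] intro: less_imp_le)
  next
    case False
    then show ?thesis
      using C by (intro exI[of _ "insert (Suc p, Suc q) C"])
        (auto simp: is_chain_def intro: less_imp_le)
  qed
qed (auto intro!: exI[of _ "{}"] simp: is_chain_def)

definition reshape :: "(real \<Rightarrow> real) \<Rightarrow> (nat \<times> nat \<Rightarrow> real) \<Rightarrow> nat \<times> nat \<Rightarrow> real" where
  "reshape \<phi> f = (\<lambda>(p, q). \<phi> (height f p q) - \<phi> (max (height f (p - 1) q) (height f p (q - 1))))"

lemma height_rec:
  "1 \<le> p \<Longrightarrow> 1 \<le> q \<Longrightarrow> height f p q = f (p, q) + max (height f (p - 1) q) (height f p (q - 1))"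
  by (cases p; cases q) auto

text \<open>The sum telescopes: the previous cell of the path is one of the two neighbours in the
  maximum, so by monotonicity the value subtracted at a cell is at least \<open>\<phi>\<close> of
  the height at the previous cell.\<close>

lemma reshape_path_sum_le:
  assumes f: "\<And>c. 0 \<le> f c" and mono: "\<And>s t. 0 \<le> s \<Longrightarrow> s \<le> t \<Longrightarrow> t \<le> C \<Longrightarrow> \<phi> s \<le> \<phi> t"
    and le: "\<And>p q. height f p q \<le> C"
    and d: "d \<noteq> []" "set d \<subseteq> coord_pairs n"
      "successively (\<lambda>(i, j) q. q = (i + 1, j) \<or> q = (i, j + 1)) d"
  shows "(\<Sum>c\<leftarrow>d. reshape \<phi> f c) \<le> \<phi> (case last d of (p, q) \<Rightarrow> height f p q) - \<phi> 0"
  using d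
proof (induction d rule: rev_induct)
  case (snoc c d)
  obtain p q where c: "c = (p, q)" by (cases c)
  have pq: "1 \<le> p" "1 \<le> q" using snoc.prems c by (auto simp: coord_pairs_def)
  note nn = height_nonneg[of f, OF f]
  show ?case
  proof (cases "d = []")
    case True
    have "\<phi> 0 \<le> \<phi> (max (height f (p - 1) q) (height f p (q - 1)))"
      by (intro mono) (auto simp: le nn le_max_iff_disj)
    then show ?thesis using True c by (simp add: reshape_def)
  next
    case False
    obtain p' q' where l: "last d = (p', q')" by (cases "last d")
    have step: "(p, q) = (p' + 1, q') \<or> (p, q) = (p', q' + 1)"
      using snoc.prems(3) False c l by (auto simp: successively_append_iff)
    have "\<phi> (height f p' q') \<le> \<phi> (max (height f (p - 1) q) (height f p (q - 1)))"
      by (intro mono) (use step in \<open>auto simp: le nn\<close>)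
    moreover have "(\<Sum>c\<leftarrow>d. reshape \<phi> f c) \<le> \<phi> (height f p' q') - \<phi> 0"
      using snoc False l by (auto simp: successively_append_iff)
    ultimately show ?thesis using c by (simp add: reshape_def)
  qed
qed simp

text \<open>In terms of heights the polytope behaves like an order polytope, so the heights of an
  extreme point are \<open>0\<close> or \<open>c\<close>. The coordinates, being differences of
  heights, are then \<open>0\<close> or \<open>c\<close> as well, and two comparable nonzero cells
  would exceed the chain bound \<open>c\<close>.\<close>

lemma extreme_point_fundamental:
  assumes v: "v extreme_point_of fflv_polytope n (fundamental_multiple c i)"
    and c: "c > 0" and i: "1 \<le> i" "i < n"
  obtains A where "A \<subseteq> rect n i" "is_antichain A"
    "v = coords_of n (\<lambda>p. if p \<in> A then real c else 0)"
proof -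
  let ?P = "fflv_polytope n (fundamental_multiple c i)"
  define f where "f = Poly_Mapping.lookup v"
  have vP: "v \<in> ?P" using v by (simp add: extreme_point_of_def)
  have f0: "0 \<le> f p" for p unfolding f_def by (rule fflv_polytope_lookup_nonneg[OF vP])
  have fout: "f p = 0" if "p \<notin> rect n i" for p
    unfolding f_def by (rule lookup_fundamental_outside_rect[OF vP that])
  have chain_le: "sum f D \<le> real c" if "is_chain D" "D \<subseteq> rect n i" for D
  proof -
    have "sum f D \<le> (\<Sum>j = 1..n - 1. real (fundamental_multiple c i j))"
      unfolding f_def using that i rect_subset_coord_pairs[of n i]
      by (intro chain_sum_le[OF vP]) (auto simp: rect_def)
    also have "\<dots> = (\<Sum>j\<in>{1..n - 1}. if i = j then real c else 0)"
      by (intro sum.cong) (auto simp: fundamental_multiple_def)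
    also have "\<dots> = real c" using i by simp
    finally show ?thesis .
  qed
  have hle: "height f p q \<le> real c" for p q
  proof -
    obtain C where C: "is_chain C" "\<forall>c\<in>C. f c \<noteq> 0" "height f p q = sum f C"
      using height_chain[of p q f] by auto
    have "C \<subseteq> rect n i" using C(2) fout by blast
    then show ?thesis using chain_le[OF C(1)] C(3) by simp
  qed
  note hnn = height_nonneg[of f, OF f0]
  define w where "w \<phi> = coords_of n (reshape \<phi> f)" for \<phi>
  have wP: "w \<phi> \<in> ?P"
    if mono: "\<And>s t. 0 \<le> s \<Longrightarrow> s \<le> t \<Longrightarrow> t \<le> real c \<Longrightarrow> \<phi> s \<le> \<phi> t" and \<phi>0: "\<phi> 0 = 0" and \<phi>c: "\<phi> (real c) = real c" for \<phi>
  proof -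
    \<comment> \<open>Where \<open>f\<close> vanishes, the height equals the maximum it is compared
      with, so reshaping by any \<open>\<phi>\<close> keeps the zero.\<close>
    have z: "reshape \<phi> f p = 0" if "p \<in> coord_pairs n" "f p = 0" for p
      using that height_rec[of "fst p" "snd p" f] by (cases p) (auto simp: reshape_def coord_pairs_def)
    have "path_sum (w \<phi>) d \<le> real (path_bound (fundamental_multiple c i) d)" if d: "dyck_path n d" for d
    proof -
      have dc: "d \<noteq> []" "set d \<subseteq> coord_pairs n"
        "successively (\<lambda>(i, j) q. q = (i + 1, j) \<or> q = (i, j + 1)) d"
        using d by (auto simp: dyck_path_def)
      have eq: "path_sum (w \<phi>) d = (\<Sum>c\<leftarrow>d. reshape \<phi> f c)"
        unfolding path_sum_def w_def using dc(2) by (intro arg_cong[where f = sum_list] map_cong) auto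
      show ?thesis
      proof (cases "fst (hd d) \<le> i \<and> i \<le> fst (last d)")
        case True
        obtain p q where l: "last d = (p, q)" by (cases "last d")
        have "path_sum (w \<phi>) d \<le> \<phi> (height f p q)"
          using reshape_path_sum_le[of f "real c" \<phi>, OF f0 mono hle dc] eq l \<phi>0 by simp
        also have "\<dots> \<le> \<phi> (real c)" by (intro mono hle hnn) auto
        finally show ?thesis using True \<phi>c by (simp add: path_bound_fundamental_multiple)
      next
        case False
        have "reshape \<phi> f p = 0" if "p \<in> set d" for p
        proof (rule z)
          show "p \<in> coord_pairs n" using that dc by auto
          show "f p = 0"
          proof (rule fout)
            show "p \<notin> rect n i"
              using False that dyck_path_bounds[OF d, of "fst p" "snd p"]
              by (cases p) (auto simp: rect_def)
          qed
        qed
        then have "(\<Sum>c\<leftarrow>d. reshape \<phi> f c) = (\<Sum>c\<leftarrow>d. 0)"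
          by (intro arg_cong[where f = sum_list] map_cong) auto
        then show ?thesis using eq by simp
      qed
    qed
    moreover have "0 \<le> reshape \<phi> f p" if "p \<in> coord_pairs n" for p
    proof -
      obtain r s where rs: "p = (r, s)" by (cases p)
      have "\<phi> (max (height f (r - 1) s) (height f r (s - 1))) \<le> \<phi> (height f r s)"
        using that rs height_rec[of r s f] f0[of p]
        by (intro mono hle) (auto simp: hnn le_max_iff_disj coord_pairs_def)
      then show ?thesis using rs by (simp add: reshape_def)
    qed
    ultimately show ?thesis by (auto simp: fflv_polytope_def w_def)
  qed
  \<comment> \<open>Two increasing self-maps of \<open>[0, c]\<close> fixing the endpoints, with mean the identity, and different
    at every interior point: an extreme point can therefore only have heights \<open>0\<close> and \<open>c\<close>.\<close>
  let ?sq = "\<lambda>t::real. t\<^sup>2 / real c" and ?cs = "\<lambda>t::real. 2 * t - t\<^sup>2 / real c"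
  have 1: "w ?sq \<in> ?P"
    by (rule wP) (use c in \<open>auto simp: power2_eq_square intro!: divide_right_mono mult_mono\<close>)
  have 2: "w ?cs \<in> ?P"
  proof (rule wP)
    fix s t :: real assume st: "0 \<le> s" "s \<le> t" "t \<le> real c"
    have "0 \<le> (t - s) * (2 * real c - (t + s))" using st by (intro mult_nonneg_nonneg) auto
    then have "(t\<^sup>2 - s\<^sup>2) / real c \<le> 2 * (t - s)"
      using c by (subst pos_divide_le_eq) (auto simp: algebra_simps power2_eq_square)
    then show "?cs s \<le> ?cs t" by (simp add: diff_divide_distrib)
  qed (use c in \<open>auto simp: power2_eq_square\<close>)
  \<comment> \<open>The mean of the two maps is the identity, and reshaping by the identity gives
    back \<open>f\<close>.\<close>
  have "v = (1 - 1/2) *\<^sub>R w ?sq + (1/2) *\<^sub>R w ?cs"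
  proof (rule poly_mapping_eqI)
    fix p
    show "Poly_Mapping.lookup v p = Poly_Mapping.lookup ((1 - 1/2) *\<^sub>R w ?sq + (1/2) *\<^sub>R w ?cs) p"
    proof (cases "p \<in> coord_pairs n")
      case True
      then show ?thesis
        using height_rec[of "fst p" "snd p" f]
        by (cases p) (auto simp: lookup_add lookup_scaleR w_def reshape_def coord_pairs_def f_def field_simps)
    next
      case False
      then show ?thesis
        using fout[of p] rect_subset_coord_pairs[of n i]
        by (auto simp: lookup_add lookup_scaleR w_def f_def)
    qed
  qed
  then have "v \<in> open_segment (w ?sq) (w ?cs)" if "w ?sq \<noteq> w ?cs"
    unfolding in_segment using that by (intro conjI exI[of _ "1/2"]) simp_all
  then have "w ?sq = w ?cs" using v 1 2 unfolding extreme_point_of_def by blast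
  then have weq: "reshape ?sq f p = reshape ?cs f p" if "p \<in> coord_pairs n" for p
    using that lookup_coords_of[of n "reshape ?sq f" p] lookup_coords_of[of n "reshape ?cs f" p]
    by (simp add: w_def)
  have h01: "height f p q \<in> {0, real c}" for p q
  proof (induction "p + q" arbitrary: p q rule: less_induct)
    case less
    show ?case
    proof (cases "1 \<le> p \<and> 1 \<le> q")
      case False
      then have "p = 0 \<or> q = 0" by auto
      then show ?thesis by (cases p) auto
    next
      case True
      let ?m = "max (height f (p - 1) q) (height f p (q - 1))"
      have m: "?m \<in> {0, real c}"
        using less[of "p - 1" q] less[of p "q - 1"] True by (auto simp: max_def)
      show ?thesis
      proof (cases "(p, q) \<in> coord_pairs n")
        case False
        then have "f (p, q) = 0" using fout rect_subset_coord_pairs[of n i] by auto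
        then show ?thesis using m True by (simp add: height_rec)
      next
        case pq: True
        let ?h = "height f p q"
        \<comment> \<open>The two reshaped values agree only if \<open>t * (c - t)\<close> takes the
          same value at \<open>?h\<close> and \<open>?m\<close>; at \<open>?m\<close> it is
          \<open>0\<close> by induction.\<close>
        have "?h\<^sup>2 / real c - ?m\<^sup>2 / real c = 2 * ?h - ?h\<^sup>2 / real c - (2 * ?m - ?m\<^sup>2 / real c)"
          using weq[OF pq] by (simp only: reshape_def prod.case)
        then have "?h - ?h\<^sup>2 / real c = ?m - ?m\<^sup>2 / real c" by linarith
        then have "real c * (?h - ?h\<^sup>2 / real c) = real c * (?m - ?m\<^sup>2 / real c)"
          by (rule arg_cong)
        then have "?h * (real c - ?h) = ?m * (real c - ?m)"
          using c by (simp add: right_diff_distrib power2_eq_square mult.commute)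
        also have "\<dots> = 0" using m by auto
        finally show ?thesis by auto
      qed
    qed
  qed
  define A where "A = {p. f p \<noteq> 0}"
  have fA: "f p = real c" if "p \<in> A" for p
  proof -
    obtain r s where rs: "p = (r, s)" by (cases p)
    have "p \<in> rect n i" using that fout unfolding A_def by blast
    then have "height f r s = f p + max (height f (r - 1) s) (height f r (s - 1))"
      using rs height_rec[of r s f] by (simp add: rect_def)
    moreover have "max (height f (r - 1) s) (height f r (s - 1)) \<in> {0, real c}"
      using h01 by (auto simp: max_def)
    ultimately show ?thesis
      using h01[of r s] f0[of p] that c by (auto simp: A_def)
  qed
  show ?thesis
  proof
    show AR: "A \<subseteq> rect n i" using fout unfolding A_def by blast
    show "is_antichain A"
      unfolding is_antichain_def
    proof (intro ballI impI, rule ccontr)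
      fix x y assume xy: "x \<in> A" "y \<in> A" "x \<le> y" "x \<noteq> y"
      then have "sum f {x, y} \<le> real c" using AR by (intro chain_le) (auto simp: is_chain_def)
      then show False using fA xy c by simp
    qed
    show "v = coords_of n (\<lambda>p. if p \<in> A then real c else 0)"
    proof (rule poly_mapping_eqI)
      fix p
      show "Poly_Mapping.lookup v p = Poly_Mapping.lookup (coords_of n (\<lambda>p. if p \<in> A then real c else 0)) p"
        using fA[of p] AR rect_subset_coord_pairs[of n i] by (auto simp: f_def A_def)
    qed
  qed
qed

subsection \<open>Exchanging cells between adjacent antichains\<close>

text \<open>Swap \<open>X\<close> and \<open>Y\<close> in the first summand only, or in the second
  only. The two resulting points lie on opposite sides of the given one, and they differ unless
  \<open>X = Y\<close>.\<close>

lemma exchange_closed_eq: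
  assumes A: "A \<subseteq> rect n i" "is_antichain A" and B: "B \<subseteq> rect n (i + 1)" "is_antichain B"
    and c: "c > 0" "c' > 0"
    and ext: "(coords_of n (\<lambda>p. if p \<in> A then real c else 0) +
        coords_of n (\<lambda>p. if p \<in> B then real c' else 0)) extreme_point_of
      (fflv_polytope n (fundamental_multiple c i) + fflv_polytope n (fundamental_multiple c' (i + 1)))"
    and XY: "X \<subseteq> A" "Y \<subseteq> B"
    and closed: "\<And>x y. x \<in> A \<Longrightarrow> y \<in> B \<Longrightarrow> x \<le> y \<or> y \<le> x \<Longrightarrow> x \<in> X \<longleftrightarrow> y \<in> Y"
    and X: "\<And>x. x \<in> X \<Longrightarrow> snd x \<noteq> i + 1" and Y: "\<And>y. y \<in> Y \<Longrightarrow> fst y \<noteq> i + 1"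
  shows "X = Y"
proof (rule ccontr)
  assume ne: "X \<noteq> Y"
  let ?I = "\<lambda>c A. coords_of n (\<lambda>p. if p \<in> A then real c else 0)"
  let ?P = "fflv_polytope n (fundamental_multiple c i)"
  let ?Q = "fflv_polytope n (fundamental_multiple c' (i + 1))"
  define A' where "A' = (A - X) \<union> Y"
  define B' where "B' = (B - Y) \<union> X"
  have pairs: "A \<subseteq> coord_pairs n" "B \<subseteq> coord_pairs n"
    using A B rect_subset_coord_pairs by blast+
  \<comment> \<open>A cell of \<open>X\<close> off column \<open>i + 1\<close> also lies in the
    rectangle of \<open>i + 1\<close>, and a cell of \<open>Y\<close> off row \<open>i + 1\<close>
    in that of \<open>i\<close>.\<close>
  have "A' \<subseteq> rect n i" "B' \<subseteq> rect n (i + 1)"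
    using A B XY X Y by (fastforce simp: A'_def B'_def rect_def le_Suc_eq)+
  moreover have "is_antichain A'" "is_antichain B'"
    using A(2) B(2) XY closed unfolding is_antichain_def A'_def B'_def by blast+
  ultimately have "?I c A' \<in> ?P" "?I c' B' \<in> ?Q"
    by (simp_all add: antichain_in_fundamental)
  moreover have "?I c A \<in> ?P" "?I c' B \<in> ?Q"
    using A B by (simp_all add: antichain_in_fundamental)
  ultimately have mem: "?I c A' + ?I c' B \<in> ?P + ?Q" "?I c A + ?I c' B' \<in> ?P + ?Q"
    by auto
  \<comment> \<open>A cell in both \<open>A\<close> and \<open>B\<close> is comparable to itself, so
    it lies in both of \<open>X\<close> and \<open>Y\<close> or in neither. Hence the indicators of
    \<open>A'\<close> and \<open>B'\<close> change by exactly the difference of those of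
    \<open>X\<close> and \<open>Y\<close>.\<close>
  have mA: "p \<in> A' \<longleftrightarrow> (p \<in> A \<and> p \<notin> X) \<or> p \<in> Y" and mB: "p \<in> B' \<longleftrightarrow> (p \<in> B \<and> p \<notin> Y) \<or> p \<in> X"
    and AB: "p \<in> A \<Longrightarrow> p \<in> B \<Longrightarrow> p \<in> X \<longleftrightarrow> p \<in> Y" for p
    using closed[of p p] by (auto simp: A'_def B'_def)
  obtain p where p: "p \<in> X \<longleftrightarrow> p \<notin> Y" using ne by auto
  then have "Poly_Mapping.lookup (?I c A' + ?I c' B) p \<noteq> Poly_Mapping.lookup (?I c A + ?I c' B') p"
    using XY pairs c AB[of p] mA[of p] mB[of p] by (auto simp: lookup_add)
  then have neq: "?I c A' + ?I c' B \<noteq> ?I c A + ?I c' B'" by metis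
  \<comment> \<open>This weight balances the displacements, which have sizes \<open>c\<close> and
    \<open>c'\<close>.\<close>
  define t where "t = real c / (real c + real c')"
  have t: "0 < t" "t < 1" using c by (auto simp: t_def)
  have tc: "(1 - t) * real c = t * real c'" using c by (simp add: t_def field_simps)
  have "?I c A + ?I c' B = (1 - t) *\<^sub>R (?I c A' + ?I c' B) + t *\<^sub>R (?I c A + ?I c' B')"
  proof (rule poly_mapping_eqI)
    fix p
    show "Poly_Mapping.lookup (?I c A + ?I c' B) p =
      Poly_Mapping.lookup ((1 - t) *\<^sub>R (?I c A' + ?I c' B) + t *\<^sub>R (?I c A + ?I c' B')) p"
      unfolding lookup_add lookup_scaleR lookup_coords_of
      using XY pairs AB[of p] mA[of p] mB[of p] tc
      by (cases "p \<in> A"; cases "p \<in> B"; cases "p \<in> X"; cases "p \<in> Y")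
        (auto simp: algebra_simps)
  qed
  then have "?I c A + ?I c' B \<in> open_segment (?I c A' + ?I c' B) (?I c A + ?I c' B')"
    using neq t by (auto simp: in_segment)
  then show False using ext mem by (auto simp: extreme_point_of_def)
qed

subsection \<open>Chains through rigid families of antichains\<close>

text \<open>In the application \<open>u\<close> is the difference of the endpoints of a segment
  through the sum of the vertices. \<open>rigid\<close> concludes \<open>X = Y\<close> rather than
  emptiness because exchanging a shared cell with itself changes nothing.\<close>

locale exchange_rigid =
  fixes n :: nat and A :: "nat \<Rightarrow> (nat \<times> nat) set" and u :: "nat \<times> nat \<Rightarrow> real"
  assumes rect: "\<And>i. 1 \<le> i \<Longrightarrow> i < n \<Longrightarrow> A i \<subseteq> rect n i"
    and antichain: "\<And>i. 1 \<le> i \<Longrightarrow> i < n \<Longrightarrow> is_antichain (A i)"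
    and rigid: "\<And>i X Y. 1 \<le> i \<Longrightarrow> i + 1 < n \<Longrightarrow> X \<subseteq> A i \<Longrightarrow> Y \<subseteq> A (i + 1) \<Longrightarrow>
      (\<And>x y. x \<in> A i \<Longrightarrow> y \<in> A (i + 1) \<Longrightarrow> x \<le> y \<or> y \<le> x \<Longrightarrow> x \<in> X \<longleftrightarrow> y \<in> Y) \<Longrightarrow>
      (\<And>x. x \<in> X \<Longrightarrow> snd x \<noteq> i + 1) \<Longrightarrow> (\<And>y. y \<in> Y \<Longrightarrow> fst y \<noteq> i + 1) \<Longrightarrow> X = Y"
    and tight: "\<And>k m C. 1 \<le> k \<Longrightarrow> k \<le> m \<Longrightarrow> m < n \<Longrightarrow> is_chain C \<Longrightarrow> C \<subseteq> coord_pairs n \<Longrightarrow>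
      (\<And>c. c \<in> C \<Longrightarrow> k \<le> fst c) \<Longrightarrow> (\<And>c. c \<in> C \<Longrightarrow> snd c \<le> m + 1) \<Longrightarrow>
      (\<And>j. k \<le> j \<Longrightarrow> j \<le> m \<Longrightarrow> C \<inter> A j \<noteq> {}) \<Longrightarrow> sum u C = 0"
begin

text \<open>
  \<open>lower i s C\<close> and \<open>upper i s C\<close>: the initial part up to \<open>s\<close>, respectively the final part from \<open>s\<close>,
  of a chain to which \<open>tight\<close> applies.
\<close>

definition lower :: "nat \<Rightarrow> nat \<times> nat \<Rightarrow> (nat \<times> nat) set \<Rightarrow> bool" where
  "lower i s C \<longleftrightarrow> is_chain C \<and> C \<subseteq> coord_pairs n \<and> s \<in> C \<and> s \<in> A i \<and> (\<forall>c\<in>C. c \<le> s) \<and>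
     (\<exists>k\<in>{1..i}. (\<forall>c\<in>C. k \<le> fst c) \<and> (\<forall>j\<in>{k..i}. C \<inter> A j \<noteq> {}))"

definition upper :: "nat \<Rightarrow> nat \<times> nat \<Rightarrow> (nat \<times> nat) set \<Rightarrow> bool" where
  "upper i s C \<longleftrightarrow> is_chain C \<and> C \<subseteq> coord_pairs n \<and> s \<in> C \<and> s \<in> A i \<and> (\<forall>c\<in>C. s \<le> c) \<and>
     (\<exists>m\<in>{i..<n}. (\<forall>c\<in>C. snd c \<le> m + 1) \<and> (\<forall>j\<in>{i..m}. C \<inter> A j \<noteq> {}))"

lemma cell: "1 \<le> i \<Longrightarrow> i < n \<Longrightarrow> s \<in> A i \<Longrightarrow> 1 \<le> fst s \<and> fst s \<le> i \<and> i < snd s \<and> snd s \<le> n \<and> s \<in> coord_pairs n"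
  using rect[of i] rect_subset_coord_pairs[of n i] by (auto simp: rect_def)

text \<open>The lower chain supplies the starting row and the antichains up to \<open>i\<close>, the
  upper chain the final column and those from \<open>i'\<close> on. Together they form a chain to
  which \<open>tight\<close> applies.\<close>

lemma sum_lower_upper:
  assumes C: "lower i s C" and D: "upper i' s' D" and i: "i' = i \<or> i' = i + 1" and s: "s \<le> s'"
  shows "sum u (C \<union> D) = 0"
proof -
  obtain k where k: "k \<in> {1..i}" "\<forall>c\<in>C. k \<le> fst c" "\<forall>j\<in>{k..i}. C \<inter> A j \<noteq> {}"
    using C by (auto simp: lower_def)
  obtain m where m: "m \<in> {i'..<n}" "\<forall>c\<in>D. snd c \<le> m + 1" "\<forall>j\<in>{i'..m}. D \<inter> A j \<noteq> {}"
    using D by (auto simp: upper_def)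
  have le: "c \<le> d" if "c \<in> C" "d \<in> D" for c d
    using that C D s unfolding lower_def upper_def by (meson order_trans)
  show ?thesis
  proof (rule tight)
    show "1 \<le> k" "k \<le> m" "m < n" using k m i by auto
    show "is_chain (C \<union> D)" using C D le by (auto simp: is_chain_def lower_def upper_def)
    show "C \<union> D \<subseteq> coord_pairs n" using C D by (auto simp: lower_def upper_def)
    show "k \<le> fst c" if "c \<in> C \<union> D" for c
    proof (cases "c \<in> C")
      case False
      then have "s \<le> c" using le that C by (auto simp: lower_def)
      then have "fst s \<le> fst c" by (simp add: less_eq_prod_def)
      moreover have "k \<le> fst s" using k C by (auto simp: lower_def)
      ultimately show ?thesis by simp
    qed (use k in auto)
    show "snd c \<le> m + 1" if "c \<in> C \<union> D" for c
    proof (cases "c \<in> D")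
      case False
      then have "c \<le> s'" using le that D by (auto simp: upper_def)
      then have "snd c \<le> snd s'" by (simp add: less_eq_prod_def)
      moreover have "snd s' \<le> m + 1" using m D by (auto simp: upper_def)
      ultimately show ?thesis by simp
    qed (use m in auto)
    show "(C \<union> D) \<inter> A j \<noteq> {}" if "k \<le> j" "j \<le> m" for j
    proof (cases "j \<le> i")
      case True
      then have "C \<inter> A j \<noteq> {}" using k that by auto
      then show ?thesis by auto
    next
      case False
      then have "D \<inter> A j \<noteq> {}" using m that i by auto
      then show ?thesis by auto
    qed
  qed
qed

section \<open>Starting and prolonging lower and upper chains\<close>

lemma lower_singleton:
  "1 \<le> i \<Longrightarrow> i < n \<Longrightarrow> s \<in> A i \<Longrightarrow> fst s = i \<Longrightarrow> lower i s {s}"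
  using cell[of i s] by (auto simp: lower_def is_chain_def intro!: bexI[of _ i])

lemma upper_singleton:
  "1 \<le> i \<Longrightarrow> i < n \<Longrightarrow> s \<in> A i \<Longrightarrow> snd s = i + 1 \<Longrightarrow> upper i s {s}"
  using cell[of i s] by (auto simp: upper_def is_chain_def intro!: bexI[of _ i])

text \<open>With \<open>r = s\<close> the chain is unchanged and only its index advances; this is
  how shared cells are treated.\<close>

lemma lower_insert:
  assumes "lower i r C" "s \<in> A (i + 1)" "r \<le> s" "i + 1 < n"
  shows "lower (i + 1) s (insert s C)"
proof -
  obtain k where k: "k \<in> {1..i}" "\<forall>c\<in>C. k \<le> fst c" "\<forall>j\<in>{k..i}. C \<inter> A j \<noteq> {}"
    using assms by (auto simp: lower_def)
  have le: "c \<le> s" if "c \<in> C" for c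
    using that assms unfolding lower_def by (meson order_trans)
  have "k \<le> fst r" using k assms by (auto simp: lower_def)
  then have "k \<le> fst s" using assms(3) by (simp add: less_eq_prod_def)
  moreover have "insert s C \<inter> A j \<noteq> {}" if "k \<le> j" "j \<le> i + 1" for j
    using k(3) that assms(2) by (cases "j = i + 1") auto
  ultimately have "\<exists>k\<in>{1..i + 1}. (\<forall>c\<in>insert s C. k \<le> fst c) \<and> (\<forall>j\<in>{k..i + 1}. insert s C \<inter> A j \<noteq> {})"
    using k by (intro bexI[of _ k] conjI ballI) auto
  then show ?thesis
    using assms le cell[of "i + 1" s] unfolding lower_def is_chain_def by auto
qed

lemma upper_insert:
  assumes "upper (i + 1) r C" "s \<in> A i" "s \<le> r" "1 \<le> i" "i < n"
  shows "upper i s (insert s C)"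
proof -
  obtain m where m: "m \<in> {i + 1..<n}" "\<forall>c\<in>C. snd c \<le> m + 1" "\<forall>j\<in>{i + 1..m}. C \<inter> A j \<noteq> {}"
    using assms by (auto simp: upper_def)
  have le: "s \<le> c" if "c \<in> C" for c
    using that assms unfolding upper_def by (meson order_trans)
  have "snd r \<le> m + 1" using m assms by (auto simp: upper_def)
  then have "snd s \<le> m + 1" using assms(3) by (simp add: less_eq_prod_def)
  moreover have "insert s C \<inter> A j \<noteq> {}" if "i \<le> j" "j \<le> m" for j
    using m(3) that assms(2) by (cases "j = i") auto
  ultimately have "\<exists>m\<in>{i..<n}. (\<forall>c\<in>insert s C. snd c \<le> m + 1) \<and> (\<forall>j\<in>{i..m}. insert s C \<inter> A j \<noteq> {})"
    using m by (intro bexI[of _ m] conjI ballI) auto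
  then show ?thesis
    using assms le cell[of i s] unfolding upper_def is_chain_def by auto
qed

section \<open>Order relations between consecutive antichains\<close>

lemma not_less_across:
  assumes i: "1 \<le> i" "i + 1 < n" and "x \<in> A i" "y \<in> A (i + 1)"
  shows "\<not> y < x"
proof
  assume "y < x"
  \<comment> \<open>The cells in a wrong-way comparison form an exchangeable pair: a comparison
    leaving it would produce two comparable cells in one antichain.\<close>
  let ?X = "{x \<in> A i. \<exists>y\<in>A (i + 1). y < x}" and ?Y = "{y \<in> A (i + 1). \<exists>x\<in>A i. y < x}"
  have anti: "\<not> a < b" if "a \<in> A i \<and> b \<in> A i \<or> a \<in> A (i + 1) \<and> b \<in> A (i + 1)" for a b
    using antichain[of i] antichain[of "i + 1"] i that by (auto simp: is_antichain_def less_le)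
  have "?X = ?Y"
  proof (rule rigid[OF i])
    fix a b assume ab: "a \<in> A i" "b \<in> A (i + 1)" "a \<le> b \<or> b \<le> a"
    show "a \<in> ?X \<longleftrightarrow> b \<in> ?Y"
    proof (cases "b < a")
      case False
      then have "a \<le> b" using ab by (auto simp: less_le)
      have "a \<notin> ?X" using ab anti \<open>a \<le> b\<close> less_le_trans by blast
      moreover have "b \<notin> ?Y" using ab anti \<open>a \<le> b\<close> le_less_trans by blast
      ultimately show ?thesis by blast
    qed (use ab in auto)
  next
    fix a assume "a \<in> ?X"
    then obtain b where "b \<in> A (i + 1)" "b < a" by auto
    then show "snd a \<noteq> i + 1" using cell[of "i + 1" b] i by (auto simp: less_prod_def less_eq_prod_def)
  next
    fix b assume "b \<in> ?Y"
    then obtain a where "a \<in> A i" "b < a" by auto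
    then show "fst b \<noteq> i + 1" using cell[of i a] i by (auto simp: less_prod_def less_eq_prod_def)
  qed auto
  moreover have "x \<in> ?X" using assms \<open>y < x\<close> by auto
  ultimately have "x \<in> A (i + 1)" by auto
  then show False using anti assms(4) \<open>y < x\<close> by blast
qed

text \<open>Otherwise \<open>x\<close> is comparable to nothing in \<open>A (i + 1)\<close>, and
  \<open>{x}\<close> can be exchanged with the empty set.\<close>

lemma ex_above:
  assumes i: "1 \<le> i" "i + 1 < n" and x: "x \<in> A i" "snd x \<noteq> i + 1"
  shows "\<exists>y\<in>A (i + 1). x \<le> y"
proof (rule ccontr)
  assume "\<not> ?thesis"
  then have "{x} = {}"
    using x not_less_across[OF i x(1)] by (intro rigid[OF i]) (auto simp: less_le)
  then show False by simp
qed

lemma ex_below: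
  assumes i: "1 \<le> i" "i + 1 < n" and y: "y \<in> A (i + 1)" "fst y \<noteq> i + 1"
  shows "\<exists>x\<in>A i. x \<le> y"
proof (rule ccontr)
  assume "\<not> ?thesis"
  then have "{} = {y}"
    using y not_less_across[OF i _ y(1)] by (intro rigid[OF i]) (auto simp: less_le)
  then show False by simp
qed

text \<open>Descend through the antichains until the current cell of \<open>A i\<close> lies in row
  \<open>i\<close>, at the latest for \<open>i = 1\<close>; a chain can start there.\<close>

lemma ex_lower: "1 \<le> i \<Longrightarrow> i < n \<Longrightarrow> s \<in> A i \<Longrightarrow> \<exists>C. lower i s C"
proof (induction i arbitrary: s)
  case (Suc i)
  show ?case
  proof (cases "fst s = Suc i")
    case True
    then show ?thesis using lower_singleton[of "Suc i" s] Suc.prems by auto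
  next
    case False
    then have "1 \<le> i" using cell[OF Suc.prems] by auto
    then obtain r where "r \<in> A i" "r \<le> s" using ex_below[of i s] False Suc.prems by auto
    then show ?thesis using Suc.IH[of r] lower_insert[of i r _ s] \<open>1 \<le> i\<close> Suc.prems by auto
  qed
qed simp

lemma ex_upper: "1 \<le> i \<Longrightarrow> i < n \<Longrightarrow> s \<in> A i \<Longrightarrow> \<exists>C. upper i s C"
proof (induction "n - i" arbitrary: i s)
  case (Suc k)
  show ?case
  proof (cases "snd s = i + 1")
    case True
    then show ?thesis using upper_singleton[of i s] Suc.prems by auto
  next
    case False
    then have "i + 1 < n" using cell[OF Suc.prems] by auto
    then obtain r where "r \<in> A (i + 1)" "s \<le> r" using ex_above[of i s] False Suc.prems by auto
    moreover have "k = n - (i + 1)" using Suc.hyps(2) by simp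
    ultimately show ?thesis
      using Suc.hyps(1)[of "i + 1" r] upper_insert[of i r _ s] \<open>i + 1 < n\<close> Suc.prems by auto
  qed
qed simp

section \<open>Vanishing of sums over lower and upper chains\<close>

definition lower_null :: "nat \<Rightarrow> nat \<times> nat \<Rightarrow> bool" where
  "lower_null i s \<longleftrightarrow> (\<forall>C. lower i s C \<longrightarrow> sum u C = 0)"

definition upper_null :: "nat \<Rightarrow> nat \<times> nat \<Rightarrow> bool" where
  "upper_null i s \<longleftrightarrow> (\<forall>C. upper i s C \<longrightarrow> sum u C = 0)"

lemma finite_lower: "lower i s C \<Longrightarrow> finite C"
  by (auto simp: lower_def intro: finite_subset[OF _ finite_coord_pairs])

lemma finite_upper: "upper i s C \<Longrightarrow> finite C"
  by (auto simp: upper_def intro: finite_subset[OF _ finite_coord_pairs])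

text \<open>Every lower sum at \<open>x\<close> is minus every upper sum at \<open>y\<close>. Both
  kinds of chain exist, so one kind vanishes exactly when the other does.\<close>

lemma lower_null_iff_upper_null:
  assumes i: "1 \<le> i" "i + 1 < n" and xy: "x \<in> A i" "y \<in> A (i + 1)" "x < y"
  shows "lower_null i x \<longleftrightarrow> upper_null (i + 1) y"
proof -
  have add: "sum u C + sum u D = 0" if C: "lower i x C" and D: "upper (i + 1) y D" for C D
  proof -
    have "C \<inter> D = {}"
      using C D xy(3) unfolding lower_def upper_def by (meson disjoint_iff leD order_trans)
    then have "sum u (C \<union> D) = sum u C + sum u D"
      using C D by (intro sum.union_disjoint finite_lower finite_upper)
    then show ?thesis using sum_lower_upper[OF C D] xy(3) by simp
  qed
  obtain C D where "lower i x C" "upper (i + 1) y D"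
    using ex_lower[of i x] ex_upper[of "i + 1" y] i xy by auto
  then show ?thesis using add unfolding lower_null_def upper_null_def
    by (metis add.right_neutral add.left_neutral)
qed

text \<open>The unshared cells violating the claim form an exchangeable pair: nullity passes along
  comparabilities, and shared cells are comparable only to themselves.\<close>

lemma null_if_not_shared:
  assumes i: "1 \<le> i" "i + 1 < n"
  shows "\<And>x. x \<in> A i \<Longrightarrow> x \<notin> A (i + 1) \<Longrightarrow> lower_null i x"
    and "\<And>y. y \<in> A (i + 1) \<Longrightarrow> y \<notin> A i \<Longrightarrow> upper_null (i + 1) y"
proof -
  let ?X = "{x \<in> A i. x \<notin> A (i + 1) \<and> \<not> lower_null i x}"
  let ?Y = "{y \<in> A (i + 1). y \<notin> A i \<and> \<not> upper_null (i + 1) y}"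
  have "?X = ?Y"
  proof (rule rigid[OF i])
    fix x y assume xy: "x \<in> A i" "y \<in> A (i + 1)" "x \<le> y \<or> y \<le> x"
    then have "x \<le> y" using not_less_across[OF i xy(1,2)] by (auto simp: less_le)
    show "x \<in> ?X \<longleftrightarrow> y \<in> ?Y"
    proof (cases "x = y")
      case False
      then have "x < y" using \<open>x \<le> y\<close> by simp
      then have "x \<notin> A (i + 1)" "y \<notin> A i"
        using antichain[of i] antichain[of "i + 1"] i xy by (auto simp: is_antichain_def less_le)
      then show ?thesis using lower_null_iff_upper_null[OF i xy(1,2) \<open>x < y\<close>] xy by auto
    qed (use xy in auto)
  next
    fix x assume x: "x \<in> ?X"
    show "snd x \<noteq> i + 1"
    proof
      \<comment> \<open>In this column \<open>{x}\<close> is itself an upper chain, so each lower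
        chain of \<open>x\<close> is already covered by \<open>tight\<close>.\<close>
      assume "snd x = i + 1"
      then have up: "upper i x {x}" using x i upper_singleton by auto
      have "sum u C = 0" if C: "lower i x C" for C
      proof -
        have "C \<union> {x} = C" using C by (auto simp: lower_def)
        then show ?thesis using sum_lower_upper[OF C up] by simp
      qed
      then show False using x by (auto simp: lower_null_def)
    qed
  next
    fix y assume y: "y \<in> ?Y"
    show "fst y \<noteq> i + 1"
    proof
      assume "fst y = i + 1"
      then have lo: "lower (i + 1) y {y}" using y i lower_singleton by auto
      have "sum u C = 0" if C: "upper (i + 1) y C" for C
      proof -
        have "{y} \<union> C = C" using C by (auto simp: upper_def)
        then show ?thesis using sum_lower_upper[OF lo C] by simp
      qed
      then show False using y by (auto simp: upper_null_def)
    qed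
  qed auto
  \<comment> \<open>\<open>?X\<close> avoids \<open>A (i + 1)\<close>, which contains
    \<open>?Y\<close>.\<close>
  then have "?X = {}" "?Y = {}" by blast+
  then show "\<And>x. x \<in> A i \<Longrightarrow> x \<notin> A (i + 1) \<Longrightarrow> lower_null i x"
    and "\<And>y. y \<in> A (i + 1) \<Longrightarrow> y \<notin> A i \<Longrightarrow> upper_null (i + 1) y"
    by blast+
qed

text \<open>
  A cell shared by \<open>A i\<close> and \<open>A (i + 1)\<close> is a whole component on its own, about which \<open>rigid\<close> says
  nothing; its lower chains at \<open>i\<close> are also lower chains at \<open>i + 1\<close>.
\<close>

lemma lower_null: "1 \<le> i \<Longrightarrow> i < n \<Longrightarrow> s \<in> A i \<Longrightarrow> lower_null i s"
proof (induction "n - i" arbitrary: i)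
  case (Suc k)
  show ?case
  proof (cases "i + 1 < n")
    case False
    \<comment> \<open>Here \<open>i = n - 1\<close>, so \<open>s\<close> lies in the last column
      \<open>n = i + 1\<close>.\<close>
    then have up: "upper i s {s}" using upper_singleton[of i s] cell[OF Suc.prems] Suc.prems by auto
    show ?thesis
      unfolding lower_null_def
    proof (intro allI impI)
      fix C assume C: "lower i s C"
      then have "C \<union> {s} = C" by (auto simp: lower_def)
      then show "sum u C = 0" using sum_lower_upper[OF C up] by simp
    qed
  next
    case True
    show ?thesis
    proof (cases "s \<in> A (i + 1)")
      case False
      then show ?thesis using null_if_not_shared(1)[of i s] True Suc.prems by auto
    next
      case shared: True
      moreover have "k = n - (i + 1)" using Suc.hyps(2) by simp
      ultimately have null: "lower_null (i + 1) s" using Suc.hyps(1)[of "i + 1"] True by auto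
      show ?thesis
        unfolding lower_null_def
      proof (intro allI impI)
        fix C assume C: "lower i s C"
        then have "insert s C = C" by (auto simp: lower_def)
        then show "sum u C = 0"
          using lower_insert[OF C shared order_refl True] null by (simp add: lower_null_def)
      qed
    qed
  qed
qed simp

text \<open>Dually, a shared cell is passed down to \<open>A (i - 1)\<close>; for
  \<open>i = 1\<close> every cell lies in row \<open>1\<close>, where a singleton is a lower
  chain.\<close>

lemma upper_null: "1 \<le> i \<Longrightarrow> i < n \<Longrightarrow> s \<in> A i \<Longrightarrow> upper_null i s"
proof (induction i)
  case (Suc i)
  show ?case
  proof (cases "i = 0")
    case True
    then have lo: "lower (Suc i) s {s}" using lower_singleton[of "Suc i" s] cell[OF Suc.prems] Suc.prems by auto
    show ?thesis
      unfolding upper_null_def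
    proof (intro allI impI)
      fix C assume C: "upper (Suc i) s C"
      then have "{s} \<union> C = C" by (auto simp: upper_def)
      then show "sum u C = 0" using sum_lower_upper[OF lo C] by simp
    qed
  next
    case False
    show ?thesis
    proof (cases "s \<in> A i")
      case notin: False
      then show ?thesis using null_if_not_shared(2)[of i s] False Suc.prems by auto
    next
      case shared: True
      then have null: "upper_null i s" using Suc.IH False Suc.prems by auto
      show ?thesis
        unfolding upper_null_def
      proof (intro allI impI)
        fix C assume C: "upper (Suc i) s C"
        then have "insert s C = C" by (auto simp: upper_def)
        then show "sum u C = 0"
          using upper_insert[of i s C s] C shared False Suc.prems null by (simp add: upper_null_def)
      qed
    qed
  qed
qed simp

text \<open>Inclusion-exclusion: a lower and an upper chain of \<open>s\<close> meet only in
  \<open>s\<close>, and they and their union all have sum zero.\<close>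

lemma direction_eq_0:
  assumes i: "1 \<le> i" "i < n" and s: "s \<in> A i"
  shows "u s = 0"
proof -
  obtain C D where C: "lower i s C" and D: "upper i s D"
    using ex_lower ex_upper assms by blast
  have "sum u C = 0" "sum u D = 0"
    using lower_null upper_null assms C D by (auto simp: lower_null_def upper_null_def)
  moreover have "sum u (C \<union> D) = 0" using sum_lower_upper[OF C D] by simp
  moreover have "C \<inter> D = {s}"
    using C D unfolding lower_def upper_def by (auto intro: antisym)
  moreover have "sum u (C \<union> D) + sum u (C \<inter> D) = sum u C + sum u D"
    using C D by (intro sum.union_inter finite_lower finite_upper)
  ultimately show ?thesis by simp
qed

end

subsection \<open>Minkowski sums\<close>

lemma path_sum_add: "path_sum (x + y) d = path_sum x d + path_sum y d"
  by (simp add: path_sum_def lookup_add sum_list_addf)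

lemma path_sum_sum: "path_sum (\<Sum>i\<in>I. x i) d = (\<Sum>i\<in>I. path_sum (x i) d)"
  by (induction I rule: infinite_finite_induct) (simp_all add: path_sum_add, simp_all add: path_sum_def)

text \<open>On a Dyck path the bounds add up: index \<open>i\<close> contributes \<open>a i\<close>
  exactly when it lies between the rows of the end cells.\<close>

lemma sum_in_fflv_polytope:
  assumes x: "\<And>i. i \<in> {1..n - 1} \<Longrightarrow> x i \<in> fflv_polytope n (fundamental_multiple (a i) i)"
  shows "(\<Sum>i = 1..n - 1. x i) \<in> fflv_polytope n a"
proof -
  have "path_sum (\<Sum>i = 1..n - 1. x i) d \<le> real (path_bound a d)" if d: "dyck_path n d" for d
  proof -
    have ends: "hd d \<in> coord_pairs n" "last d \<in> coord_pairs n"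
      using d by (auto simp: dyck_path_def)
    have "path_sum (\<Sum>i = 1..n - 1. x i) d \<le>
      (\<Sum>i = 1..n - 1. real (path_bound (fundamental_multiple (a i) i) d))"
      unfolding path_sum_sum using x d by (intro sum_mono) (auto simp: fflv_polytope_def)
    also have "\<dots> = (\<Sum>i = 1..n - 1. if i \<in> {fst (hd d)..fst (last d)} then real (a i) else 0)"
      by (intro sum.cong) (auto simp: path_bound_fundamental_multiple)
    also have "\<dots> = (\<Sum>i\<in>{1..n - 1} \<inter> {fst (hd d)..fst (last d)}. real (a i))"
      by (rule sum.inter_restrict[symmetric]) simp
    also have "{1..n - 1} \<inter> {fst (hd d)..fst (last d)} = {fst (hd d)..fst (last d)}"
      using ends by (auto simp: coord_pairs_def)
    finally show ?thesis by (simp add: path_bound_def)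
  qed
  moreover have "(\<Sum>i = 1..n - 1. x i) \<in> coord_space n"
  proof -
    have "Poly_Mapping.lookup (x i) p = 0" if "i \<in> {1..n - 1}" "p \<notin> coord_pairs n" for i p
      using x[OF that(1)] that(2) by (auto simp: fflv_polytope_def lookup_eq_0_outside)
    then have "Poly_Mapping.lookup (\<Sum>i = 1..n - 1. x i) p = 0" if "p \<notin> coord_pairs n" for p
      unfolding lookup_sum using that by (intro sum.neutral) blast
    then show ?thesis by (auto simp: coord_space_def in_keys_iff)
  qed
  moreover have "0 \<le> Poly_Mapping.lookup (\<Sum>i = 1..n - 1. x i) p" for p
    unfolding lookup_sum using x fflv_polytope_lookup_nonneg by (intro sum_nonneg) blast
  ultimately show ?thesis by (auto simp: fflv_polytope_def)
qed

text \<open>Translation by \<open>z\<close> carries a segment in \<open>T\<close> through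
  \<open>x\<close> to one in \<open>S\<close> through \<open>x + z\<close>.\<close>

lemma extreme_point_of_summand:
  assumes "(x + z) extreme_point_of S" "x \<in> T" "\<And>y. y \<in> T \<Longrightarrow> y + z \<in> S"
  shows "x extreme_point_of T"
  unfolding extreme_point_of_def
proof (intro conjI ballI notI)
  fix y y' assume y: "y \<in> T" "y' \<in> T" "x \<in> open_segment y y'"
  then have "z + x \<in> open_segment (z + y) (z + y')"
    by simp
  then show False using assms y by (auto simp: extreme_point_of_def add.commute)
qed (use assms in auto)

theorem theorem1p1:
  fixes n :: nat and a :: "nat \<Rightarrow> nat" and v :: "nat \<Rightarrow> coords"
  assumes "n \<ge> 2"
    and "\<forall>i\<in>{1..n - 1}. a i > 0"
    and "\<forall>i\<in>{1..n - 1}. v i extreme_point_of fflv_polytope n (fundamental_multiple (a i) i)"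
  shows "(\<Sum>i = 1..n - 1. v i) extreme_point_of fflv_polytope n a \<longleftrightarrow>
    (\<forall>i\<in>{1..n - 2}. (v i + v (i + 1)) extreme_point_of
       (fflv_polytope n (fundamental_multiple (a i) i) +
        fflv_polytope n (fundamental_multiple (a (i + 1)) (i + 1))))"
proof
  let ?P = "\<lambda>i. fflv_polytope n (fundamental_multiple (a i) i)"
  have vP: "v i \<in> ?P i" if "i \<in> {1..n - 1}" for i
    using assms(3) that by (auto simp: extreme_point_of_def)
  {
    assume ext: "(\<Sum>i = 1..n - 1. v i) extreme_point_of fflv_polytope n a"
    show "\<forall>i\<in>{1..n - 2}. (v i + v (i + 1)) extreme_point_of (?P i + ?P (i + 1))"
    proof
      fix i assume i: "i \<in> {1..n - 2}"
      let ?J = "{1..n - 1} - {i, i + 1}"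
      have split: "(\<Sum>j = 1..n - 1. w j) = w i + w (i + 1) + sum w ?J" for w :: "nat \<Rightarrow> coords"
      proof -
        have "(\<Sum>j = 1..n - 1. w j) = sum w {i, i + 1} + sum w ?J"
          using i by (subst sum.subset_diff[of "{i, i + 1}"]) (auto simp: add.commute)
        then show ?thesis by simp
      qed
      show "(v i + v (i + 1)) extreme_point_of (?P i + ?P (i + 1))"
      proof (rule extreme_point_of_summand)
        show "(v i + v (i + 1) + sum v ?J) extreme_point_of fflv_polytope n a"
          using ext unfolding split[of v] .
        show "v i + v (i + 1) \<in> ?P i + ?P (i + 1)"
          using vP i by (intro set_plus_intro) auto
        fix y assume "y \<in> ?P i + ?P (i + 1)"
        then obtain p q where pq: "y = p + q" "p \<in> ?P i" "q \<in> ?P (i + 1)" by (auto elim: set_plus_elim)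
        \<comment> \<open>The two summands become arbitrary points of their polytopes while the
          other vertices stay fixed.\<close>
        define w where "w = v(i := p, i + 1 := q)"
        have "(\<Sum>j = 1..n - 1. w j) \<in> fflv_polytope n a"
          using pq vP by (intro sum_in_fflv_polytope) (auto simp: w_def)
        moreover have "sum w ?J = sum v ?J" by (intro sum.cong) (auto simp: w_def)
        ultimately show "y + sum v ?J \<in> fflv_polytope n a"
          unfolding split[of w] by (simp add: w_def pq)
      qed
    qed
  }
  assume adj: "\<forall>i\<in>{1..n - 2}. (v i + v (i + 1)) extreme_point_of (?P i + ?P (i + 1))"
  have "\<forall>i\<in>{1..n - 1}. \<exists>A. A \<subseteq> rect n i \<and> is_antichain A \<and>
    v i = coords_of n (\<lambda>p. if p \<in> A then real (a i) else 0)"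
  proof
    fix i assume "i \<in> {1..n - 1}"
    then have "v i extreme_point_of ?P i" "0 < a i" "1 \<le> i" "i < n"
      using assms by auto
    then obtain A where "A \<subseteq> rect n i" "is_antichain A"
      "v i = coords_of n (\<lambda>p. if p \<in> A then real (a i) else 0)"
      by (rule extreme_point_fundamental)
    then show "\<exists>A. A \<subseteq> rect n i \<and> is_antichain A \<and>
      v i = coords_of n (\<lambda>p. if p \<in> A then real (a i) else 0)" by blast
  qed
  from bchoice[OF this] obtain A where "\<forall>i\<in>{1..n - 1}. A i \<subseteq> rect n i \<and> is_antichain (A i) \<and>
    v i = coords_of n (\<lambda>p. if p \<in> A i then real (a i) else 0)" ..
  then have A: "A i \<subseteq> rect n i" "is_antichain (A i)"
    "v i = coords_of n (\<lambda>p. if p \<in> A i then real (a i) else 0)" if "i \<in> {1..n - 1}" for i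
    using that by blast+
  define x where "x = (\<Sum>i = 1..n - 1. v i)"
  have xP: "x \<in> fflv_polytope n a" unfolding x_def by (intro sum_in_fflv_polytope vP)
  have "x \<notin> open_segment y z" if yz: "y \<in> fflv_polytope n a" "z \<in> fflv_polytope n a" for y z
  proof
    assume "x \<in> open_segment y z"
    then obtain t where t: "0 < t" "t < 1" and xt: "x = (1 - t) *\<^sub>R y + t *\<^sub>R z" and "y \<noteq> z"
      by (auto simp: in_segment)
    define u where "u c = Poly_Mapping.lookup y c - Poly_Mapping.lookup z c" for c
    \<comment> \<open>An inequality tight at a proper convex combination is tight at both
      endpoints.\<close>
    have convex_eq: "r = s" if "r \<le> b" "s \<le> b" "b \<le> (1 - t) * r + t * s" for r s b :: real
    proof -
      have "(1 - t) * (b - r) + t * (b - s) \<le> 0" using that(3) by (simp add: algebra_simps)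
      moreover have "0 \<le> (1 - t) * (b - r)" "0 \<le> t * (b - s)" using that t by auto
      ultimately have "(1 - t) * (b - r) = 0" "t * (b - s) = 0" by linarith+
      then show ?thesis using t by auto
    qed
    interpret exchange_rigid n A u
    proof
      show "A i \<subseteq> rect n i" "is_antichain (A i)" if "1 \<le> i" "i < n" for i using A[of i] that by auto
    next
      fix i X Y
      assume i: "1 \<le> i" "i + 1 < n" and XY: "X \<subseteq> A i" "Y \<subseteq> A (i + 1)"
        "\<And>x y. x \<in> A i \<Longrightarrow> y \<in> A (i + 1) \<Longrightarrow> x \<le> y \<or> y \<le> x \<Longrightarrow> x \<in> X \<longleftrightarrow> y \<in> Y"
        "\<And>x. x \<in> X \<Longrightarrow> snd x \<noteq> i + 1" "\<And>y. y \<in> Y \<Longrightarrow> fst y \<noteq> i + 1"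
      have ii: "i \<in> {1..n - 1}" "i + 1 \<in> {1..n - 1}" "i \<in> {1..n - 2}" using i by auto
      show "X = Y"
      proof (rule exchange_closed_eq[OF A(1,2)[OF ii(1)] A(1,2)[OF ii(2)] _ _ _ XY])
        show "0 < a i" "0 < a (i + 1)" using assms(2) ii by blast+
        show "(coords_of n (\<lambda>p. if p \<in> A i then real (a i) else 0) +
          coords_of n (\<lambda>p. if p \<in> A (i + 1) then real (a (i + 1)) else 0)) extreme_point_of
          (?P i + ?P (i + 1))"
          using adj ii(3) unfolding A(3)[OF ii(1), symmetric] A(3)[OF ii(2), symmetric] by blast
      qed
    next
      fix k m C
      assume km: "1 \<le> k" "k \<le> m" "m < n" and C: "is_chain C" "C \<subseteq> coord_pairs n"
        "\<And>c. c \<in> C \<Longrightarrow> k \<le> fst c" "\<And>c. c \<in> C \<Longrightarrow> snd c \<le> m + 1"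
        and meet: "\<And>j. k \<le> j \<Longrightarrow> j \<le> m \<Longrightarrow> C \<inter> A j \<noteq> {}"
      let ?b = "\<Sum>j = k..m. real (a j)"
      let ?s = "\<lambda>x. \<Sum>c\<in>C. Poly_Mapping.lookup x c"
      have fin: "finite C" using finite_subset[OF C(2)] by simp
      \<comment> \<open>Each \<open>v j\<close> has the value \<open>a j\<close> at a cell where
        \<open>C\<close> meets \<open>A j\<close>, so \<open>x\<close> attains the chain bound;
        hence so do \<open>y\<close> and \<open>z\<close>.\<close>
      have "?b \<le> (\<Sum>j = k..m. ?s (v j))"
      proof (rule sum_mono)
        fix j assume j: "j \<in> {k..m}"
        then obtain c where c: "c \<in> C" "c \<in> A j" using meet[of j] by auto
        have j': "j \<in> {1..n - 1}" using j km by auto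
        have "real (a j) = Poly_Mapping.lookup (v j) c"
          using A(3)[OF j'] c C(2) by auto
        also have "\<dots> \<le> ?s (v j)"
          using c fin vP[OF j'] fflv_polytope_lookup_nonneg by (intro member_le_sum) blast+
        finally show "real (a j) \<le> ?s (v j)" .
      qed
      also have "\<dots> \<le> (\<Sum>j = 1..n - 1. ?s (v j))"
      proof (rule sum_mono2)
        show "0 \<le> ?s (v j)" if "j \<in> {1..n - 1} - {k..m}" for j
          using that vP fflv_polytope_lookup_nonneg by (intro sum_nonneg) blast
      qed (use km in auto)
      also have "\<dots> = ?s x"
        unfolding x_def lookup_sum by (rule sum.swap)
      also have "\<dots> = (1 - t) * ?s y + t * ?s z"
        by (simp add: xt lookup_add lookup_scaleR sum.distrib sum_distrib_left)
      finally have "?s y = ?s z"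
        by (intro convex_eq[of _ ?b] chain_sum_le[OF yz(1) km C] chain_sum_le[OF yz(2) km C])
      then show "sum u C = 0" by (simp add: u_def sum_subtractf)
    qed
    have "Poly_Mapping.lookup y c = Poly_Mapping.lookup z c" for c
    proof (cases "\<exists>i\<in>{1..n - 1}. c \<in> A i")
      case True
      then obtain i where "1 \<le> i" "i < n" "c \<in> A i" by force
      then have "u c = 0" by (rule direction_eq_0)
      then show ?thesis by (simp add: u_def)
    next
      case False
      then have "Poly_Mapping.lookup x c = 0"
        unfolding x_def lookup_sum using A(3) by (intro sum.neutral) auto
      \<comment> \<open>Off all the antichains \<open>x\<close> vanishes, so nonnegativity, written
        as an upper bound \<open>0\<close> on the negated coordinates, is tight.\<close>
      then have "0 \<le> (1 - t) * (- Poly_Mapping.lookup y c) + t * (- Poly_Mapping.lookup z c)"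
        by (simp add: xt lookup_add lookup_scaleR)
      then show ?thesis
        using convex_eq[of "- Poly_Mapping.lookup y c" 0 "- Poly_Mapping.lookup z c"]
          fflv_polytope_lookup_nonneg[OF yz(1), of c] fflv_polytope_lookup_nonneg[OF yz(2), of c]
        by simp
    qed
    then have "y = z" by (intro poly_mapping_eqI)
    then show False using \<open>y \<noteq> z\<close> by simp
  qed
  then show "(\<Sum>i = 1..n - 1. v i) extreme_point_of fflv_polytope n a"
    using xP by (auto simp: extreme_point_of_def x_def)
qed

end
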